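(* Let $f\in C([-1,1])$ and set $\hat R_{r,n}[f](x):=f(x)-\hat P_{r,n}[f](x)$ and $R_r[f](x):=f(x)-P_r[f](x)$ for $x\in[-1,1]$, where $P_r[f]$ is the Lagrange interpolation polynomial of $f$ at the node set $X'_m\cup X'''_p$. Then for all $x\in[-1,1]$ $$\hat R_{r,n}[f](x)=f(x)-\hat P_{r,n}[f](x)=R_r[f](x)+\sum_{j=0}^p\ell_{j,p}(x)\,\hat R_{r,n}[f](x'''_j),$$ where $$\ell_{j,p}(x)=\prod_{k=0}^{m}\frac{x-x'_k}{x'''_j-x'_k}\ \prod_{\substack{s=0\\ s\ne j}}^{p}\frac{x-x'''_s}{x'''_j-x'''_s},\qquad j=0,\dots,p,$$ are the Lagrange fundamental polynomials on $X'_m\cup X'''_p$ associated with the nodes $x'''_j$.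
   Context: Let $n$ be a (sufficiently large) positive integer and let $X_n=\{-1+\tfrac{2}{n}i : i=0,\dots,n\}$ be the set of $n+1$ equispaced nodes in $[-1,1]$. Put $m=\lfloor \pi\sqrt{n/2}\rfloor$, $p=\lfloor \tfrac{\pi}{\sqrt2}\sqrt{n/6}\rfloor$, $r=m+p+1$; $n$ is large enough that $r\le n$. $\Pi_k$ denotes the space of real polynomials of degree $\le k$. $X'_m=\{x'_0,\dots,x'_m\}\subset X_n$ is the mock-Chebyshev subset: $m+1$ pairwise distinct nodes of $X_n$ that best mimic the Chebyshev--Lobatto nodes, i.e. $x'_k$ is the node of $X_n$ closest to $-\cos(k\pi/m)$ (a neighbouring grid node being used if necessary to keep the nodes distinct). The elements of $X_n$ are reordered as $x_0,\dots,x_n$ so that $x_i=x'_i$ for $i=0,\dots,m$. Let $X''_{n-m}=X_n\setminus X'_m$. For $n$ sufficiently large an equispaced grid of $q=\lfloor n/6\rfloor$ internal nodes of $[-1,1]$ can be approximated by $q$ distinct nodes belonging to $X''_{n-m}$; this set of nodes is denoted $\tilde X''_{n-m}$. $X'''_p=\{x'''_0,\dots,x'''_p\}$ is the mock-Chebyshev subset of $\tilde X''_{n-m}$, i.e. $p+1$ pairwise distinct points of $\tilde X''_{n-m}$ chosen to best mimic Chebyshev--Lobatto nodes. In particular $X'_m\cup X'''_p$ consists of $r+1$ distinct points of $X_n$, and $P_r[f]\in\Pi_r$ is the unique polynomial of degree $\le r$ interpolating $f$ at them. Let $\{u_0,\dots,u_r\}$ be the Chebyshev basis of the first kind of $\Pi_r$,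 $u_k(x)=T_k(x)=\cos(k\arccos x)$. Let $V=[u_j(x_i)]_{i=0,\dots,n;\ j=0,\dots,r}$ and $C=[u_j(x_i)]_{i=0,\dots,m;\ j=0,\dots,r}$. The KKT matrix $$M=\begin{bmatrix}2V^TV & C^T\\ C&0\end{bmatrix}$$ is nonsingular. For $f\in C([-1,1])$ let $\boldsymbol b=[f(x_0),\dots,f(x_n)]^T$, $\boldsymbol d=[f(x_0),\dots,f(x_m)]^T$, and let $(\hat{\boldsymbol a},\hat{\boldsymbol z})$ with $\hat{\boldsymbol a}=[\hat a_0,\dots,\hat a_r]^T$, $\hat{\boldsymbol z}\in\mathbb R^{m+1}$, be the unique solution of $$M\begin{bmatrix}\hat{\boldsymbol a}\\ \hat{\boldsymbol z}\end{bmatrix}=\begin{bmatrix}2V^T\boldsymbol b\\ \boldsymbol d\end{bmatrix}.$$ The constrained mock-Chebyshev least squares operator is $\hat P_{r,n}[f](x)=\sum_{i=0}^r\hat a_iu_i(x)$, $x\in[-1,1]$. *)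

theory Defs
  imports
    Complex_Main
    "HOL-Computational_Algebra.Polynomial"
    "Jordan_Normal_Form.Matrix"
begin

definition equispaced_nodes :: "nat \<Rightarrow> real set" where
  "equispaced_nodes n = (\<lambda>i. - 1 + 2 / real n * real i) ` {0..n}"

definition deg_m :: "nat \<Rightarrow> nat" where
  "deg_m n = nat \<lfloor>pi * sqrt (real n / 2)\<rfloor>"

definition deg_p :: "nat \<Rightarrow> nat" where
  "deg_p n = nat \<lfloor>pi / sqrt 2 * sqrt (real n / 6)\<rfloor>"

definition deg_r :: "nat \<Rightarrow> nat" where
  "deg_r n = deg_m n + deg_p n + 1"

text \<open>
  The points \<open>y k\<close> with \<open>k \<in> K\<close> are pairwise distinct elements of \<open>S\<close>, and each \<open>y k\<close> is
  closest to the target \<open>t k\<close> among the elements of \<open>S\<close> that no other index occupies. So \<open>y k\<close>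
  is the closest element of \<open>S\<close> unless that element is already taken, and the next available
  one is used in that case. Ties, and the order in which collisions are resolved, are left
  open, so the relation does not determine \<open>y\<close> in general.
\<close>

definition mimics :: "real set \<Rightarrow> nat set \<Rightarrow> (nat \<Rightarrow> real) \<Rightarrow> (nat \<Rightarrow> real) \<Rightarrow> bool" where
  "mimics S K t y \<longleftrightarrow>
     inj_on y K \<and>
     (\<forall>k\<in>K. is_arg_min (\<lambda>s. \<bar>s - t k\<bar>) (\<lambda>s. s \<in> S - y ` (K - {k})) (y k))"

definition mock_Chebyshev :: "real set \<Rightarrow> nat \<Rightarrow> (nat \<Rightarrow> real) \<Rightarrow> bool" where
  "mock_Chebyshev S d y \<longleftrightarrow> mimics S {0..d} (\<lambda>k. - cos (real k * pi / real d)) y"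

definition internal_equispaced :: "nat \<Rightarrow> (nat \<Rightarrow> real) \<Rightarrow> bool" where
  "internal_equispaced q g \<longleftrightarrow>
     (\<exists>a h. 0 < h \<and> (\<forall>i<q. g i = a + real i * h \<and> - 1 < g i \<and> g i < 1))"

definition mimics_internal_grid :: "real set \<Rightarrow> nat \<Rightarrow> real set \<Rightarrow> bool" where
  "mimics_internal_grid S q T \<longleftrightarrow>
     (\<exists>g y. internal_equispaced q g \<and> mimics S {0..<q} g y \<and> T = y ` {0..<q})"

definition Cheb_T :: "nat \<Rightarrow> real \<Rightarrow> real" where
  "Cheb_T k x = cos (real k * arccos x)"

definition V_mat :: "nat \<Rightarrow> nat \<Rightarrow> (nat \<Rightarrow> real) \<Rightarrow> real mat" where
  "V_mat n r x = mat (n + 1) (r + 1) (\<lambda>(i, j). Cheb_T j (x i))"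

definition C_mat :: "nat \<Rightarrow> nat \<Rightarrow> (nat \<Rightarrow> real) \<Rightarrow> real mat" where
  "C_mat m r x = mat (m + 1) (r + 1) (\<lambda>(i, j). Cheb_T j (x i))"

definition KKT_mat :: "nat \<Rightarrow> nat \<Rightarrow> nat \<Rightarrow> (nat \<Rightarrow> real) \<Rightarrow> real mat" where
  "KKT_mat n m r x =
     four_block_mat
       (2 \<cdot>\<^sub>m (transpose_mat (V_mat n r x) * V_mat n r x)) (transpose_mat (C_mat m r x))
       (C_mat m r x) (0\<^sub>m (m + 1) (m + 1))"

definition KKT_rhs :: "nat \<Rightarrow> nat \<Rightarrow> nat \<Rightarrow> (nat \<Rightarrow> real) \<Rightarrow> (real \<Rightarrow> real) \<Rightarrow> real vec" where
  "KKT_rhs n m r x f =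
     2 \<cdot>\<^sub>v (transpose_mat (V_mat n r x) *\<^sub>v vec (n + 1) (\<lambda>i. f (x i)))
       @\<^sub>v vec (m + 1) (\<lambda>i. f (x i))"

text \<open>
  The stacked vector \<open>(a, z)\<close>: entries \<open>0, \<dots>, r\<close> are the coefficients \<open>a\<close>, the remaining
  \<open>m + 1\<close> entries are the multipliers \<open>z\<close>.
\<close>

definition KKT_solution :: "nat \<Rightarrow> nat \<Rightarrow> nat \<Rightarrow> (nat \<Rightarrow> real) \<Rightarrow> (real \<Rightarrow> real) \<Rightarrow> real vec" where
  "KKT_solution n m r x f =
     (THE w. w \<in> carrier_vec ((r + 1) + (m + 1)) \<and> KKT_mat n m r x *\<^sub>v w = KKT_rhs n m r x f)"

definition constrained_mock_Chebyshev_LS ::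
  "nat \<Rightarrow> nat \<Rightarrow> nat \<Rightarrow> (nat \<Rightarrow> real) \<Rightarrow> (real \<Rightarrow> real) \<Rightarrow> real \<Rightarrow> real" where
  "constrained_mock_Chebyshev_LS n m r x f t =
     (\<Sum>i=0..r. KKT_solution n m r x f $ i * Cheb_T i t)"

definition Lagrange_interpolant :: "nat \<Rightarrow> real set \<Rightarrow> (real \<Rightarrow> real) \<Rightarrow> real poly" where
  "Lagrange_interpolant d S f = (THE P. degree P \<le> d \<and> (\<forall>s\<in>S. poly P s = f s))"

text \<open>
  \<open>fundamental m p x' x''' j\<close> is the fundamental polynomial, for the nodes
  \<open>x' 0, \<dots>, x' m, x''' 0, \<dots>, x''' p\<close>, that belongs to the node \<open>x''' j\<close>.
\<close>

definition fundamental ::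
  "nat \<Rightarrow> nat \<Rightarrow> (nat \<Rightarrow> real) \<Rightarrow> (nat \<Rightarrow> real) \<Rightarrow> nat \<Rightarrow> real \<Rightarrow> real" where
  "fundamental m p x' x''' j t =
     (\<Prod>k=0..m. (t - x' k) / (x''' j - x' k)) *
     (\<Prod>s\<in>{0..p} - {j}. (t - x''' s) / (x''' j - x''' s))"

end

theory Submission
  imports Defs "Jordan_Normal_Form.Determinant"
begin

text \<open>
  The kernel of the KKT matrix is trivial: the first component \<open>a\<close> of a kernel vector is the
  Chebyshev coefficient vector of a polynomial of degree at most \<open>r \<le> n\<close> with \<open>n + 1\<close> zeros, and
  its multipliers \<open>z\<close> annihilate all polynomials of degree at most \<open>r\<close> on the \<open>m + 1 \<le> r + 1\<close>
  constrained nodes. So the KKT solution exists, and its second block says that the constrained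
  least squares polynomial \<open>Q\<close> interpolates \<open>f\<close> at every \<open>x' k\<close>. Hence \<open>P - Q\<close>, with \<open>P\<close> the
  Lagrange interpolant, has degree at most \<open>r\<close>, vanishes at the \<open>x' k\<close> and equals \<open>f - Q\<close>
  at the \<open>x''' j\<close>; expanding it in the Lagrange basis gives the identity.
\<close>

hide_const (open) module.smult

section \<open>Lagrange interpolation on a finite subset of a field\<close>

definition lagrange_basis :: "'a::field set \<Rightarrow> 'a \<Rightarrow> 'a poly" where
  "lagrange_basis S s = (\<Prod>t\<in>S - {s}. smult (1 / (s - t)) [:- t, 1:])"

lemma poly_lagrange_basis:
  "poly (lagrange_basis S s) z = (\<Prod>t\<in>S - {s}. (z - t) / (s - t))"
  by (simp add: lagrange_basis_def poly_prod diff_divide_distrib algebra_simps)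

lemma poly_lagrange_basis_node:
  assumes "finite S" "s \<in> S" "z \<in> S"
  shows "poly (lagrange_basis S s) z = (if z = s then 1 else 0)"
  using assms by (auto simp: poly_lagrange_basis prod_zero_iff intro!: prod.neutral)

lemma degree_lagrange_basis_less:
  assumes "finite S" "s \<in> S"
  shows "degree (lagrange_basis S s) < card S"
proof -
  have "degree (lagrange_basis S s) \<le> (\<Sum>t\<in>S - {s}. degree (smult (1 / (s - t)) [:- t, 1:]))"
    unfolding lagrange_basis_def
    using degree_prod_sum_le[of "S - {s}" "\<lambda>t. smult (1 / (s - t)) [:- t, 1:]"] assms
    by (simp add: o_def)
  also have "\<dots> \<le> (\<Sum>t\<in>S - {s}. 1)"
    by (rule sum_mono) (simp add: degree_smult_eq)
  also have "\<dots> = card S - 1"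
    using assms by simp
  also have "\<dots> < card S"
    using card_gt_0_iff[of S] assms by auto
  finally show ?thesis .
qed

definition lagrange_poly :: "'a::field set \<Rightarrow> ('a \<Rightarrow> 'a) \<Rightarrow> 'a poly" where
  "lagrange_poly S g = (\<Sum>s\<in>S. smult (g s) (lagrange_basis S s))"

lemma poly_lagrange_poly:
  assumes "finite S" "z \<in> S"
  shows "poly (lagrange_poly S g) z = g z"
  using assms
  by (simp add: lagrange_poly_def poly_sum poly_lagrange_basis_node if_distrib sum.delta cong: if_cong)

lemma degree_lagrange_poly_less:
  assumes "finite S" "S \<noteq> {}"
  shows "degree (lagrange_poly S g) < card S"
  unfolding lagrange_poly_def
  using assms degree_lagrange_basis_less card_gt_0_iff
  by (intro degree_sum_less le_less_trans[OF degree_smult_le]) auto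

text \<open>Two polynomials of degree below \<open>card S\<close> that agree on \<open>S\<close>
  coincide. Besides determining the interpolant, this recovers any polynomial of small degree from
  its own values on \<open>S\<close>.\<close>

lemma lagrange_poly_unique:
  assumes "finite S" "degree P < card S" "\<And>s. s \<in> S \<Longrightarrow> poly P s = g s"
  shows "P = lagrange_poly S g"
proof -
  have "S \<noteq> {}" using assms(2) by auto
  then show ?thesis
    using assms by (intro poly_eqI_degree[of S]) (auto simp: poly_lagrange_poly degree_lagrange_poly_less)
qed

text \<open>Replaces the definite description by an explicit sum; the condition
  \<open>card S = Suc d\<close> is what gives both existence and uniqueness in degree at most
  \<open>d\<close>.\<close>

lemma Lagrange_interpolant_eq:
  assumes "finite S" "card S = Suc d"
  shows "Lagrange_interpolant d S f = lagrange_poly S f"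
  unfolding Lagrange_interpolant_def
proof (rule the_equality)
  have "S \<noteq> {}" using assms by auto
  then show "degree (lagrange_poly S f) \<le> d \<and> (\<forall>s\<in>S. poly (lagrange_poly S f) s = f s)"
    using degree_lagrange_poly_less[of S f] assms by (simp add: poly_lagrange_poly)
  show "P = lagrange_poly S f" if "degree P \<le> d \<and> (\<forall>s\<in>S. poly P s = f s)" for P
    using that assms by (intro lagrange_poly_unique) auto
qed

section \<open>Polynomial families with one member in each degree\<close>

lemma graded_family_independent:
  fixes b :: "nat \<Rightarrow> 'a::idom poly"
  assumes "\<And>j. b j \<noteq> 0" "\<And>j. degree (b j) = j"
    and "(\<Sum>j\<le>r. smult (c j) (b j)) = 0" "j \<le> r"
  shows "c j = 0"
  using assms(3,4)
proof (induction r)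
  case 0
  then show ?case using assms(1) by simp
next
  case (Suc r)
  have "degree (\<Sum>j\<le>r. smult (c j) (b j)) \<le> r"
    by (rule degree_sum_le) (auto intro: order_trans[OF degree_smult_le] simp: assms(2))
  \<comment> \<open>Only the last member reaches degree \<open>Suc r\<close>, so this coefficient
    isolates \<open>c (Suc r)\<close>.\<close>
  then have "coeff (\<Sum>j\<le>Suc r. smult (c j) (b j)) (Suc r) = c (Suc r) * lead_coeff (b (Suc r))"
    by (simp add: coeff_eq_0 assms(2))
  then have "c (Suc r) * lead_coeff (b (Suc r)) = 0"
    unfolding Suc.prems(1) by simp
  then have "c (Suc r) = 0"
    using assms(1)[of "Suc r"] by (simp del: assms(2))
  then show ?case
    using Suc by (cases "j = Suc r") auto
qed

text \<open>Induction on the degree bound: subtracting a multiple of the top member of the family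
  lowers the bound by one.\<close>

lemma graded_family_spans:
  fixes b :: "nat \<Rightarrow> 'a::field poly"
  assumes "\<And>j. b j \<noteq> 0" "\<And>j. degree (b j) = j" and "degree q \<le> r"
  shows "\<exists>c. q = (\<Sum>j\<le>r. smult (c j) (b j))"
  using assms(3)
proof (induction r arbitrary: q)
  case 0
  have "\<exists>u v. q = [:u:] \<and> b 0 = [:v:] \<and> v \<noteq> 0"
    using 0 assms(1)[of 0] assms(2)[of 0] by (metis degree_eq_zeroE le_zero_eq pCons_0_0)
  then obtain u v where "q = [:u:]" "b 0 = [:v:]" "v \<noteq> 0"
    by blast
  then show ?case
    by (intro exI[of _ "\<lambda>_. u / v"]) simp
next
  case (Suc r)
  \<comment> \<open>The multiplier that cancels the coefficient of degree \<open>Suc r\<close> in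
    \<open>q\<close>.\<close>
  define a where "a = coeff q (Suc r) / lead_coeff (b (Suc r))"
  have "coeff (q - smult a (b (Suc r))) (Suc r) = 0"
    using assms(1) assms(2)[of "Suc r"] by (simp add: a_def)
      (metis assms(2) leading_coeff_0_iff nonzero_divide_eq_eq)
  moreover have "degree (q - smult a (b (Suc r))) \<le> Suc r"
    using Suc.prems by (intro degree_diff_le) (auto intro: order_trans[OF degree_smult_le] simp: assms(2))
  ultimately have "degree (q - smult a (b (Suc r))) \<le> r"
    by (metis degree_0 le_SucE leading_coeff_0_iff le0)
  then obtain c where "q - smult a (b (Suc r)) = (\<Sum>j\<le>r. smult (c j) (b j))"
    using Suc.IH by blast
  then have "q = (\<Sum>j\<le>r. smult (c j) (b j)) + smult a (b (Suc r))"
    by (simp add: algebra_simps)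
  then show ?case
    by (intro exI[of _ "c(Suc r := a)"]) simp
qed

section \<open>Chebyshev polynomials as formal polynomials\<close>

fun cheb_poly :: "nat \<Rightarrow> real poly" where
  "cheb_poly 0 = 1"
| "cheb_poly (Suc 0) = [:0, 1:]"
| "cheb_poly (Suc (Suc k)) = [:0, 2:] * cheb_poly (Suc k) - cheb_poly k"

text \<open>In the recurrence the product with \<open>[:0, 2:]\<close> has degree
  \<open>Suc (Suc k)\<close> and dominates the subtracted term; a positive degree then excludes the
  zero polynomial.\<close>

lemma cheb_poly_graded: "degree (cheb_poly k) = k \<and> cheb_poly k \<noteq> 0"
proof (induction k rule: cheb_poly.induct)
  case (3 k)
  then have "degree ([:0, 2:] * cheb_poly (Suc k)) = Suc (Suc k)"
    by (subst degree_mult_eq) auto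
  moreover have "degree (- cheb_poly k) < Suc (Suc k)"
    using 3 by simp
  ultimately have "degree ([:0, 2:] * cheb_poly (Suc k) + - cheb_poly k) = Suc (Suc k)"
    by (subst degree_add_eq_left) auto
  then have "degree (cheb_poly (Suc (Suc k))) = Suc (Suc k)"
    by (simp del: mult_pCons_left)
  then show ?case
    by (metis degree_0 nat.distinct(1))
qed auto

text \<open>The recurrence is the addition formula for the cosine at the angle
  \<open>arccos t\<close>. The restriction on \<open>t\<close> ensures
  \<open>cos (arccos t) = t\<close>. This link makes degrees and root counting available for
  \<open>Cheb_T\<close>.\<close>

lemma poly_cheb_poly:
  assumes "t \<in> {-1..1}"
  shows "poly (cheb_poly k) t = Cheb_T k t"
proof (induction k rule: cheb_poly.induct)
  case (3 k)
  define \<theta> where "\<theta> = arccos t"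
  have t: "cos \<theta> = t" using assms by (simp add: \<theta>_def)
  have "cos (real (Suc (Suc k)) * \<theta>) + cos (real k * \<theta>) = 2 * cos \<theta> * cos (real (Suc k) * \<theta>)"
  proof -
    have "real (Suc (Suc k)) * \<theta> = real (Suc k) * \<theta> + \<theta>" "real k * \<theta> = real (Suc k) * \<theta> - \<theta>"
      by (auto simp: algebra_simps)
    then show ?thesis by (simp only: cos_add cos_diff) (simp add: algebra_simps)
  qed
  then show ?case
    using 3 t by (simp add: Cheb_T_def \<theta>_def)
qed (use assms in \<open>auto simp: Cheb_T_def\<close>)

section \<open>Chebyshev expansions and collocation matrices\<close>

definition cheb_sum :: "nat \<Rightarrow> (nat \<Rightarrow> real) \<Rightarrow> real poly" where
  "cheb_sum r a = (\<Sum>j\<le>r. smult (a j) (cheb_poly j))"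

lemma poly_cheb_sum:
  assumes "t \<in> {-1..1}"
  shows "poly (cheb_sum r a) t = (\<Sum>j\<le>r. a j * Cheb_T j t)"
  by (simp add: cheb_sum_def poly_sum poly_cheb_poly[OF assms])

lemma degree_cheb_sum: "degree (cheb_sum r a) \<le> r"
  unfolding cheb_sum_def
  by (rule degree_sum_le) (auto intro: order_trans[OF degree_smult_le] simp: cheb_poly_graded)

text \<open>Translates linear algebra into polynomial values at the nodes. Since
  \<open>V_mat\<close> is \<open>C_mat\<close> with \<open>m\<close> replaced by \<open>n\<close>,
  it serves both matrices of the KKT system.\<close>

lemma collocation_mult_vec:
  assumes "a \<in> carrier_vec (r + 1)" "\<And>i. i \<le> m \<Longrightarrow> x i \<in> {-1..1}"
  shows "C_mat m r x *\<^sub>v a = vec (m + 1) (\<lambda>i. poly (cheb_sum r (($) a)) (x i))"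
  using assms
  by (intro eq_vecI)
    (auto simp: C_mat_def scalar_prod_def poly_cheb_sum atLeast0LessThan lessThan_Suc_atMost mult.commute
      intro!: sum.cong)

lemma smult_mat_mult_vec:
  fixes A :: "'a::comm_semiring_0 mat"
  assumes "A \<in> carrier_mat nr nc" "v \<in> carrier_vec nc"
  shows "(k \<cdot>\<^sub>m A) *\<^sub>v v = k \<cdot>\<^sub>v (A *\<^sub>v v)"
  using assms by (intro eq_vecI) (auto simp: scalar_prod_def sum_distrib_left mult.assoc)

lemma V_mat_eq_C_mat: "V_mat n r x = C_mat n r x"
  by (simp add: V_mat_def C_mat_def)

lemma C_mat_carrier: "C_mat m r x \<in> carrier_mat (m + 1) (r + 1)"
  by (simp add: C_mat_def)

section \<open>The KKT system and its unique solvability\<close>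

lemma KKT_mat_carrier: "KKT_mat n m r x \<in> carrier_mat ((r + 1) + (m + 1)) ((r + 1) + (m + 1))"
  unfolding KKT_mat_def V_mat_eq_C_mat using C_mat_carrier[of n r x] C_mat_carrier[of m r x]
  by (intro four_block_carrier_mat) auto

lemma KKT_mat_mult_append:
  fixes x :: "nat \<Rightarrow> real" and n :: nat
  assumes a: "a \<in> carrier_vec (r + 1)" and z: "z \<in> carrier_vec (m + 1)"
  defines "V \<equiv> C_mat n r x" and "C \<equiv> C_mat m r x"
  shows "KKT_mat n m r x *\<^sub>v (a @\<^sub>v z) =
    (2 \<cdot>\<^sub>v (transpose_mat V *\<^sub>v (V *\<^sub>v a)) + transpose_mat C *\<^sub>v z) @\<^sub>v (C *\<^sub>v a)"
proof -
  have V: "V \<in> carrier_mat (n + 1) (r + 1)" and C: "C \<in> carrier_mat (m + 1) (r + 1)"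
    unfolding V_def C_def by (rule C_mat_carrier)+
  have "KKT_mat n m r x *\<^sub>v (a @\<^sub>v z) =
    ((2 \<cdot>\<^sub>m (transpose_mat V * V)) *\<^sub>v a + transpose_mat C *\<^sub>v z) @\<^sub>v (C *\<^sub>v a + 0\<^sub>m (m + 1) (m + 1) *\<^sub>v z)"
    unfolding KKT_mat_def V_mat_eq_C_mat V_def[symmetric] C_def[symmetric]
    using V C a z by (intro four_block_mat_mult_vec) auto
  moreover have "(2 \<cdot>\<^sub>m (transpose_mat V * V)) *\<^sub>v a = 2 \<cdot>\<^sub>v (transpose_mat V *\<^sub>v (V *\<^sub>v a))"
    using V a
    by (simp add: smult_mat_mult_vec[of _ "r + 1" "r + 1"] assoc_mult_mat_vec[of _ "r + 1" "n + 1" _ "r + 1"])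
  moreover have "C *\<^sub>v a + 0\<^sub>m (m + 1) (m + 1) *\<^sub>v z = C *\<^sub>v a"
    using C a z by (auto intro!: eq_vecI simp: scalar_prod_def)
  ultimately show ?thesis by simp
qed

lemma scalar_prod_self_eq_0D:
  fixes v :: "real vec"
  assumes "v \<bullet> v = 0"
  shows "v = 0\<^sub>v (dim_vec v)"
  using assms by (auto simp: scalar_prod_def sum_nonneg_eq_0_iff intro!: eq_vecI)

text \<open>
  Pairing the first block of the kernel equations with \<open>a\<close> gives \<open>\<bar>V a\<bar>\<^sup>2 = 0\<close>, since the
  second block removes the multiplier term.
\<close>

lemma KKT_mat_kernel:
  assumes x: "inj_on x {0..n}" "\<And>i. i \<le> n \<Longrightarrow> x i \<in> {-1..1}" and mr: "m \<le> r" and rn: "r \<le> n"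
    and a: "a \<in> carrier_vec (r + 1)" and z: "z \<in> carrier_vec (m + 1)"
    and ker: "KKT_mat n m r x *\<^sub>v (a @\<^sub>v z) = 0\<^sub>v ((r + 1) + (m + 1))"
  shows "a = 0\<^sub>v (r + 1)" "z = 0\<^sub>v (m + 1)"
proof -
  define V C where "V = C_mat n r x" and "C = C_mat m r x"
  have V: "V \<in> carrier_mat (n + 1) (r + 1)" and C: "C \<in> carrier_mat (m + 1) (r + 1)"
    unfolding V_def C_def by (rule C_mat_carrier)+
  have split: "0\<^sub>v ((r + 1) + (m + 1)) = 0\<^sub>v (r + 1) @\<^sub>v (0\<^sub>v (m + 1) :: real vec)"
    by (rule eq_vecI) (auto simp: append_vec_def)
  define u where "u = 2 \<cdot>\<^sub>v (transpose_mat V *\<^sub>v (V *\<^sub>v a)) + transpose_mat C *\<^sub>v z"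
  have u: "u \<in> carrier_vec (r + 1)"
    using carrier_matD[OF V] carrier_matD[OF C] by (intro carrier_vecI) (simp add: u_def)
  have "u @\<^sub>v (C *\<^sub>v a) = 0\<^sub>v (r + 1) @\<^sub>v 0\<^sub>v (m + 1)"
    using ker KKT_mat_mult_append[OF a z, of n x] unfolding split V_def C_def u_def by simp
  then have "u = 0\<^sub>v (r + 1) \<and> C *\<^sub>v a = 0\<^sub>v (m + 1)"
    unfolding append_vec_eq[OF u zero_carrier_vec] .
  then have stat: "2 \<cdot>\<^sub>v (transpose_mat V *\<^sub>v (V *\<^sub>v a)) + transpose_mat C *\<^sub>v z = 0\<^sub>v (r + 1)"
    and feas: "C *\<^sub>v a = 0\<^sub>v (m + 1)"
    by (simp_all only: u_def)
  have "0 = (2 \<cdot>\<^sub>v (transpose_mat V *\<^sub>v (V *\<^sub>v a)) + transpose_mat C *\<^sub>v z) \<bullet> a"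
    unfolding stat using a by simp
  also have "\<dots> = 2 * ((transpose_mat V *\<^sub>v (V *\<^sub>v a)) \<bullet> a) + (transpose_mat C *\<^sub>v z) \<bullet> a"
    using V C a z by (subst add_scalar_prod_distrib[of _ "r + 1"]) auto
  also have "(transpose_mat V *\<^sub>v (V *\<^sub>v a)) \<bullet> a = (V *\<^sub>v a) \<bullet> (V *\<^sub>v a)"
    using V a by (intro transpose_vec_mult_scalar) auto
  also have "(transpose_mat C *\<^sub>v z) \<bullet> a = z \<bullet> (C *\<^sub>v a)"
    using C a z by (intro transpose_vec_mult_scalar) auto
  finally have "(V *\<^sub>v a) \<bullet> (V *\<^sub>v a) = 0"
    using z by (simp add: feas)
  then have Va: "V *\<^sub>v a = 0\<^sub>v (n + 1)"
    using scalar_prod_self_eq_0D V by fastforce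
  have "poly (cheb_sum r (($) a)) (x i) = 0" if "i \<le> n" for i
  proof -
    have "(V *\<^sub>v a) $ i = poly (cheb_sum r (($) a)) (x i)"
      unfolding V_def using that by (subst collocation_mult_vec[OF a x(2)]) auto
    then show ?thesis using that by (simp add: Va)
  qed
  then have "cheb_sum r (($) a) = 0"
    using rn degree_cheb_sum[of r "($) a"]
    by (intro poly_eqI_degree[of "x ` {0..n}"]) (auto simp: card_image[OF x(1)])
  then have "a $ j = 0" if "j \<le> r" for j
    using that graded_family_independent[where b = cheb_poly and r = r and c = "($) a" and j = j] cheb_poly_graded
    by (simp add: cheb_sum_def)
  then show a0: "a = 0\<^sub>v (r + 1)"
    using a by (intro eq_vecI) auto
  \<comment> \<open>As \<open>V *\<^sub>v a\<close> vanishes, the first block reduces to its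
    multiplier term.\<close>
  have Ctz: "transpose_mat C *\<^sub>v z = 0\<^sub>v (r + 1)"
  proof -
    have "2 \<cdot>\<^sub>v (transpose_mat V *\<^sub>v (V *\<^sub>v a)) = 0\<^sub>v (r + 1)"
      using V unfolding Va by (auto intro!: eq_vecI)
    then show ?thesis using stat C z by simp
  qed
  have "z $ i = 0" if i: "i \<le> m" for i
  proof -
    define S where "S = x ` {0..m}"
    have inj: "inj_on x {0..m}" using x(1) mr rn by (auto intro: inj_on_subset)
    have S: "finite S" "x i \<in> S" "card S = m + 1"
      using i by (auto simp: S_def card_image[OF inj])
    \<comment> \<open>The test vector is the coefficient vector of the Lagrange basis polynomial at
      \<open>x i\<close> for the constrained nodes. Its degree is at most \<open>m \<le> r\<close>,
      so it has a Chebyshev expansion; \<open>C\<close> maps its coefficients to a unit vector, and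
      pairing with \<open>z\<close> extracts \<open>z $ i\<close>.\<close>
    obtain c where c: "lagrange_basis S (x i) = cheb_sum r c"
      using graded_family_spans[of cheb_poly "lagrange_basis S (x i)" r] cheb_poly_graded
        degree_lagrange_basis_less[OF S(1,2)] S(3) mr by (auto simp: cheb_sum_def)
    define b where "b = vec (r + 1) c"
    have "cheb_sum r (($) b) = cheb_sum r c"
      by (auto simp: cheb_sum_def b_def intro!: sum.cong)
    then have Cb: "C *\<^sub>v b = unit_vec (m + 1) i"
      unfolding C_def using x(2) mr rn inj i
      by (subst collocation_mult_vec)
        (auto simp: b_def c[symmetric] poly_lagrange_basis_node S S_def inj_on_eq_iff unit_vec_def intro!: eq_vecI)
    have "0 = (transpose_mat C *\<^sub>v z) \<bullet> b"
      unfolding Ctz by (simp add: b_def)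
    also have "\<dots> = z \<bullet> (C *\<^sub>v b)"
      using C z by (intro transpose_vec_mult_scalar) (auto simp: b_def)
    also have "\<dots> = z $ i"
      unfolding Cb using z i by simp
    finally show ?thesis by simp
  qed
  then show "z = 0\<^sub>v (m + 1)"
    using z by (intro eq_vecI) auto
qed

text \<open>A trivial kernel forces a nonzero determinant, hence a two-sided inverse matrix.\<close>

lemma ex1_linear_system:
  fixes A :: "'a::field mat"
  assumes A: "A \<in> carrier_mat N N" and b: "b \<in> carrier_vec N"
    and ker: "\<And>v. v \<in> carrier_vec N \<Longrightarrow> A *\<^sub>v v = 0\<^sub>v N \<Longrightarrow> v = 0\<^sub>v N"
  shows "\<exists>!w. w \<in> carrier_vec N \<and> A *\<^sub>v w = b"
proof -
  have "det A \<noteq> 0"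
    using ker det_0_iff_vec_prod_zero_field[OF A] by blast
  \<comment> \<open>The \<open>()\<close> only fills the extension slot of the ring record
    \<open>ring_mat\<close>.\<close>
  from det_non_zero_imp_unit[OF A this, of "()"]
  obtain B where B: "B \<in> carrier_mat N N" "B * A = 1\<^sub>m N" "A * B = 1\<^sub>m N"
    by (auto simp: Units_def ring_mat_def)
  show ?thesis
  proof (rule ex1I[of _ "B *\<^sub>v b"])
    show "B *\<^sub>v b \<in> carrier_vec N \<and> A *\<^sub>v (B *\<^sub>v b) = b"
      using A B b by (simp flip: assoc_mult_mat_vec)
    show "w = B *\<^sub>v b" if "w \<in> carrier_vec N \<and> A *\<^sub>v w = b" for w
      using that A B by (metis assoc_mult_mat_vec one_mult_mat_vec)
  qed
qed

text \<open>Justifies the definite description in \<open>KKT_solution\<close>: splitting a kernel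
  vector into coefficients and multipliers reduces uniqueness to
  \<open>KKT_mat_kernel\<close>.\<close>

lemma KKT_solution_spec:
  assumes x: "inj_on x {0..n}" "\<And>i. i \<le> n \<Longrightarrow> x i \<in> {-1..1}" and mr: "m \<le> r" and rn: "r \<le> n"
  shows "KKT_solution n m r x f \<in> carrier_vec ((r + 1) + (m + 1))"
    and "KKT_mat n m r x *\<^sub>v KKT_solution n m r x f = KKT_rhs n m r x f"
proof -
  have "KKT_rhs n m r x f \<in> carrier_vec ((r + 1) + (m + 1))"
    unfolding KKT_rhs_def V_mat_eq_C_mat using C_mat_carrier[of n r x]
    by (intro append_carrier_vec) auto
  then have "\<exists>!w. w \<in> carrier_vec ((r + 1) + (m + 1)) \<and> KKT_mat n m r x *\<^sub>v w = KKT_rhs n m r x f"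
  proof (rule ex1_linear_system[OF KKT_mat_carrier])
    fix v assume v: "v \<in> carrier_vec ((r + 1) + (m + 1))" "KKT_mat n m r x *\<^sub>v v = 0\<^sub>v ((r + 1) + (m + 1))"
    define a z where "a = vec_first v (r + 1)" and "z = vec_last v (m + 1)"
    have az: "v = a @\<^sub>v z" "a \<in> carrier_vec (r + 1)" "z \<in> carrier_vec (m + 1)"
      using v(1) by (simp_all add: a_def z_def)
    have "a = 0\<^sub>v (r + 1)" "z = 0\<^sub>v (m + 1)"
      using KKT_mat_kernel[OF x mr rn az(2,3)] v(2) az(1) by auto
    then show "v = 0\<^sub>v ((r + 1) + (m + 1))"
      unfolding az(1) by (auto intro!: eq_vecI simp: append_vec_def)
  qed
  from theI'[OF this] show "KKT_solution n m r x f \<in> carrier_vec ((r + 1) + (m + 1))"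
    and "KKT_mat n m r x *\<^sub>v KKT_solution n m r x f = KKT_rhs n m r x f"
    unfolding KKT_solution_def by auto
qed

section \<open>The least squares polynomial and the fundamental polynomials\<close>

lemma constrained_mock_Chebyshev_LS_eq_poly:
  assumes "t \<in> {-1..1}"
  shows "constrained_mock_Chebyshev_LS n m r x f t = poly (cheb_sum r (($) (KKT_solution n m r x f))) t"
  unfolding constrained_mock_Chebyshev_LS_def poly_cheb_sum[OF assms] by (simp add: atMost_atLeast0)

text \<open>The second block of the KKT equations says that \<open>C\<close> maps the coefficients
  to the data on the constrained nodes.\<close>

lemma constrained_mock_Chebyshev_LS_interpolates:
  assumes x: "inj_on x {0..n}" "\<And>i. i \<le> n \<Longrightarrow> x i \<in> {-1..1}" and mr: "m \<le> r" and rn: "r \<le> n"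
    and i: "i \<le> m"
  shows "constrained_mock_Chebyshev_LS n m r x f (x i) = f (x i)"
proof -
  define w where "w = KKT_solution n m r x f"
  define a z where "a = vec_first w (r + 1)" and "z = vec_last w (m + 1)"
  have w: "w \<in> carrier_vec ((r + 1) + (m + 1))" "KKT_mat n m r x *\<^sub>v w = KKT_rhs n m r x f"
    unfolding w_def using KKT_solution_spec[OF x mr rn] by blast+
  have az: "w = a @\<^sub>v z" and a: "a \<in> carrier_vec (r + 1)" and z: "z \<in> carrier_vec (m + 1)"
    using w(1) by (simp_all add: a_def z_def)
  note V = C_mat_carrier[of n r x] and C = C_mat_carrier[of m r x]
  have "C_mat m r x *\<^sub>v a = vec (m + 1) (\<lambda>i. f (x i))"
    using w(2) unfolding az KKT_mat_mult_append[OF a z] KKT_rhs_def V_mat_eq_C_mat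
    by (subst (asm) append_vec_eq[of _ "r + 1"]) (use V C a z in auto)
  moreover have "(C_mat m r x *\<^sub>v a) $ i = poly (cheb_sum r (($) a)) (x i)"
    using i x(2) mr rn by (subst collocation_mult_vec[OF a]) auto
  \<comment> \<open>The operator reads its coefficients from the stacked vector, but only at indices
    up to \<open>r\<close>, where that vector agrees with \<open>a\<close>.\<close>
  moreover have "cheb_sum r (($) a) = cheb_sum r (($) w)"
    using a z unfolding cheb_sum_def az by (intro sum.cong) (auto simp: append_vec_def)
  ultimately show ?thesis
    using i x(2)[of i] mr rn by (simp add: constrained_mock_Chebyshev_LS_eq_poly w_def)
qed

text \<open>Removing \<open>x''' j\<close> from the node set leaves a disjoint union, over which the
  product splits into the two factors of \<open>fundamental\<close>; injectivity turns products over
  nodes into products over indices.\<close>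

lemma fundamental_eq_lagrange_basis:
  assumes inj: "inj_on x' {0..m}" "inj_on x''' {0..p}"
    and disj: "x' ` {0..m} \<inter> x''' ` {0..p} = {}" and j: "j \<le> p"
  shows "fundamental m p x' x''' j t = poly (lagrange_basis (x' ` {0..m} \<union> x''' ` {0..p}) (x''' j)) t"
proof -
  have "x' ` {0..m} \<union> x''' ` {0..p} - {x''' j} = x' ` {0..m} \<union> x''' ` ({0..p} - {j})"
  proof -
    have "x''' j \<notin> x' ` {0..m}"
      using disj j by (metis IntI atLeastAtMost_iff empty_iff imageI zero_le)
    then show ?thesis
      using j inj_on_image_set_diff[OF inj(2), of "{0..p}" "{j}"] by auto
  qed
  moreover have "x' ` {0..m} \<inter> x''' ` ({0..p} - {j}) = {}"
    using disj by blast
  moreover have "inj_on x''' ({0..p} - {j})"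
    using inj(2) by (rule inj_on_subset) auto
  ultimately show ?thesis
    using inj(1)
    by (simp add: fundamental_def poly_lagrange_basis prod.union_disjoint prod.reindex)
qed

section \<open>Location of the nodes and the error identity\<close>

lemma mimics_image_subset: "mimics S K t y \<Longrightarrow> y ` K \<subseteq> S"
  by (auto simp: mimics_def is_arg_min_def)

lemma equispaced_nodes_subset: "equispaced_nodes n \<subseteq> {-1..1}"
proof -
  have "2 * real i / real n \<le> 2" if "i \<le> n" for i
    \<comment> \<open>For \<open>n = 0\<close> the quotient is \<open>0\<close> by the convention on
      division by zero.\<close>
    using that by (cases "n = 0") (auto simp: divide_simps)
  then show ?thesis by (auto simp: equispaced_nodes_def)
qed

theorem theorem3:
  fixes n m p r :: nat
    and x x' x''' :: "nat \<Rightarrow> real"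
    and Xt :: "real set"
    and f Rhat R :: "real \<Rightarrow> real"
  assumes n_pos: "n > 0"
    and m: "m = deg_m n" and p: "p = deg_p n" and r: "r = deg_r n"
    and r_le: "r \<le> n"
    and X': "mock_Chebyshev (equispaced_nodes n) m x'"
    and reorder: "bij_betw x {0..n} (equispaced_nodes n)" "\<forall>i\<le>m. x i = x' i"
    and Xt: "mimics_internal_grid (equispaced_nodes n - x' ` {0..m}) (n div 6) Xt"
    and X''': "mock_Chebyshev Xt p x'''"
    and f: "continuous_on {-1..1} f"
    and Rhat: "\<forall>t\<in>{-1..1}. Rhat t = f t - constrained_mock_Chebyshev_LS n m r x f t"
    and R: "\<forall>t\<in>{-1..1}. R t = f t - poly (Lagrange_interpolant r (x' ` {0..m} \<union> x''' ` {0..p}) f) t"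
  shows "\<forall>t\<in>{-1..1}.
           Rhat t = f t - constrained_mock_Chebyshev_LS n m r x f t \<and>
           Rhat t = R t + (\<Sum>j=0..p. fundamental m p x' x''' j t * Rhat (x''' j))"
proof (intro ballI conjI)
  fix t :: real assume t: "t \<in> {-1..1}"
  then show "Rhat t = f t - constrained_mock_Chebyshev_LS n m r x f t"
    using Rhat by blast
  define A B S where "A = x' ` {0..m}" and "B = x''' ` {0..p}" and "S = A \<union> B"
  have r_eq: "r = m + p + 1"
    by (simp add: m p r deg_r_def)
  have inj: "inj_on x' {0..m}" "inj_on x''' {0..p}"
    using X' X''' by (auto simp: mock_Chebyshev_def mimics_def)
  \<comment> \<open>\<open>B\<close> lies in \<open>Xt\<close>, which was itself selected from the
    grid with \<open>A\<close> removed; this yields disjointness of the two node families.\<close>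
  have "B \<subseteq> equispaced_nodes n - A"
    using X''' Xt mimics_image_subset unfolding A_def B_def mock_Chebyshev_def mimics_internal_grid_def
    by fast
  then have disj: "A \<inter> B = {}" and B: "B \<subseteq> {-1..1}"
    using equispaced_nodes_subset by auto
  have fin: "finite A" "finite B" "finite S"
    by (simp_all add: A_def B_def S_def)
  have card: "card S = Suc r"
    using card_Un_disjoint[OF fin(1,2) disj] card_image[OF inj(1)] card_image[OF inj(2)]
    by (simp add: S_def A_def B_def r_eq)
  have xinj: "inj_on x {0..n}" and xI: "\<And>i. i \<le> n \<Longrightarrow> x i \<in> {-1..1}"
    using reorder(1) equispaced_nodes_subset by (fastforce simp: bij_betw_def)+
  define Phat where "Phat = cheb_sum r (($) (KKT_solution n m r x f))"
  have Phat: "constrained_mock_Chebyshev_LS n m r x f s = poly Phat s" if "s \<in> {-1..1}" for s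
    unfolding Phat_def by (rule constrained_mock_Chebyshev_LS_eq_poly[OF that])
  have PhatA: "poly Phat s = f s" if s: "s \<in> A" for s
  proof -
    obtain i where "i \<le> m" "s = x' i"
      using s by (auto simp: A_def)
    then have i: "i \<le> m" "s = x i"
      using reorder(2) by simp_all
    then show ?thesis
      using constrained_mock_Chebyshev_LS_interpolates[OF xinj xI, of m r i f] Phat[of s] xI[of i]
        r_eq r_le by simp
  qed
  \<comment> \<open>\<open>Phat\<close> has degree at most \<open>r\<close> and \<open>S\<close> has
    \<open>r + 1\<close> points, so \<open>Phat\<close> is its own interpolant and both polynomials
    can be expanded in one basis.\<close>
  have "Phat = lagrange_poly S (poly Phat)"
    using fin(3) card degree_cheb_sum[of r] by (intro lagrange_poly_unique) (auto simp: Phat_def less_Suc_eq_le)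
  then have "poly (lagrange_poly S f) t - poly Phat t = poly (lagrange_poly S f) t - poly (lagrange_poly S (poly Phat)) t"
    by simp
  also have "\<dots> = (\<Sum>s\<in>S. poly (lagrange_basis S s) t * (f s - poly Phat s))"
    by (simp add: lagrange_poly_def poly_sum sum_subtractf algebra_simps)
  \<comment> \<open>The summands over \<open>A\<close> vanish because \<open>Phat\<close>
    interpolates \<open>f\<close> there.\<close>
  also have "\<dots> = (\<Sum>s\<in>B. poly (lagrange_basis S s) t * (f s - poly Phat s))"
    using fin PhatA by (intro sum.mono_neutral_right) (auto simp: S_def)
  also have "\<dots> = (\<Sum>s\<in>B. poly (lagrange_basis S s) t * Rhat s)"
    using B Rhat Phat by (intro sum.cong) auto
  also have "\<dots> = (\<Sum>j=0..p. poly (lagrange_basis S (x''' j)) t * Rhat (x''' j))"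
    unfolding B_def by (simp add: sum.reindex[OF inj(2)])
  also have "\<dots> = (\<Sum>j=0..p. fundamental m p x' x''' j t * Rhat (x''' j))"
    using fundamental_eq_lagrange_basis[OF inj] disj by (intro sum.cong) (auto simp: S_def A_def B_def)
  finally show "Rhat t = R t + (\<Sum>j=0..p. fundamental m p x' x''' j t * Rhat (x''' j))"
    using t Rhat R Phat Lagrange_interpolant_eq[OF fin(3) card, of f]
    by (simp add: S_def A_def B_def)
qed

end
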